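(* There is an absolute constant $C \le 32.62$ such that the following holds. Let $\Gamma\subset\mathbb{Z}^d$ be finite with $D=|\Gamma|$, let $T\subset\Gamma$ with $|T| = M$, and let $f(x)=\sum_{k\in T}c_k e^{ik\cdot x}\in\Pi_\Gamma(M)$, $f\neq 0$, be a fixed trigonometric polynomial with coefficients supported on $T$. Let the random sampling points $X=(x_1,\dots,x_N)$ be chosen according to either the continuous or the discrete probability model, and let $\epsilon>0$. If \[ N\ge C\,M\log(8D/\epsilon), \] then with probability at least $1-\epsilon$ Orthogonal Matching Pursuit (OMP), applied to the sample vector $(f(x_j))_{j=1}^N$, selects an element of the true support $T$ in the first iteration.
   Context: Let $d\in\mathbb{N}$ and let $\Gamma\subset\mathbb{Z}^d$ be finite with $D=|\Gamma|$. $\Pi_\Gamma(M)$ is the set of all trigonometric polynomials $f(x)=\sum_{k\in\Gamma}c_k e^{ik\cdot x}$, $x\in[0,2\pi]^d$, $c_k\in\mathbb{C}$, whose coefficient vector is supported on some subset of $\Gamma$ of cardinality at most $M$. Probability models for the sampling points $x_1,\dots,x_N$. (1) Continuous model: $x_1,\dots,x_N$ are independent random variables with the uniform distribution on $[0,2\pi]^d$. (2) Discrete model: for some $m\in\mathbb{N}\setminus\{1\}$, $x_1,\dots,x_N$ are independent random variables with the uniform distribution on the finite grid $\frac{2\pi}{m}\mathbb{Z}_m^d=\{0,\frac{2\pi}{m},\dots,\frac{2\pi(m-1)}{m}\}^d$; in this model it is always assumed that $\Gamma\subset\mathbb{Z}_m^d$, i.e. distinct elements of $\Gamma$ are distinct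 modulo $m$. (In model (2) some sampling points may coincide.) For $k\in\Gamma$ let $\phi_k=(e^{ik\cdot x_1},\dots,e^{ik\cdot x_N})^{\top}\in\mathbb{C}^N$, and let $\langle\cdot,\cdot\rangle$ be the Euclidean scalar product on $\mathbb{C}^N$. $\log$ is the natural logarithm. OMP starts with the residual vector $r_0=\mathrm{f}:=(f(x_j))_{j=1}^N$ and the index set $T_0=\emptyset$. In iteration $s=1,2,\dots$ it selects an index $k_s\in\arg\max_{k\in\Gamma}|\langle r_{s-1},\phi_k\rangle|$, sets $T_s=T_{s-1}\cup\{k_s\}$, and takes as new residual $r_s$ the difference between $\mathrm{f}$ and its orthogonal projection onto $\mathrm{span}\{\phi_k:k\in T_s\}$. If the maximum is attained at several indices the algorithm chooses one of them. Thus the first iteration selects some $k_1\in\arg\max_{k\in\Gamma}|\langle \mathrm{f},\phi_k\rangle|$, and the assertion is that $k_1\in T$. *)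

theory Defs
  imports "HOL-Probability.Probability"
begin

text \<open>
  Points of \<open>\<int>\<^sup>d\<close> and \<open>\<real>\<^sup>d\<close> are functions on \<open>nat\<close> that are extensional on \<open>{..<d}\<close>, so that
  the dimension is an ordinary variable and constants can be chosen independently of it.
\<close>

definition freqs :: "nat \<Rightarrow> (nat \<Rightarrow> int) set" where
  "freqs d = {..<d} \<rightarrow>\<^sub>E UNIV"

definition cube :: "nat \<Rightarrow> (nat \<Rightarrow> real) set" where
  "cube d = {..<d} \<rightarrow>\<^sub>E {0..2 * pi}"

definition character :: "nat \<Rightarrow> (nat \<Rightarrow> int) \<Rightarrow> (nat \<Rightarrow> real) \<Rightarrow> complex" where
  "character d k x = exp (\<i> * of_real (\<Sum>i<d. of_int (k i) * x i))"

definition trig_poly ::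
  "nat \<Rightarrow> (nat \<Rightarrow> int) set \<Rightarrow> ((nat \<Rightarrow> int) \<Rightarrow> complex) \<Rightarrow> (nat \<Rightarrow> real) \<Rightarrow> complex" where
  "trig_poly d T c x = (\<Sum>k\<in>T. c k * character d k x)"


definition uniform_cube :: "nat \<Rightarrow> (nat \<Rightarrow> real) measure" where
  "uniform_cube d = (\<Pi>\<^sub>M i\<in>{..<d}. uniform_measure lborel {0..2 * pi})"

definition grid :: "nat \<Rightarrow> nat \<Rightarrow> (nat \<Rightarrow> real) set" where
  "grid d m = {..<d} \<rightarrow>\<^sub>E (\<lambda>a. 2 * pi * real a / real m) ` {..<m}"

definition distinct_mod :: "nat \<Rightarrow> nat \<Rightarrow> (nat \<Rightarrow> int) set \<Rightarrow> bool" where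
  "distinct_mod d m \<Gamma> \<longleftrightarrow>
     (\<forall>k\<in>\<Gamma>. \<forall>l\<in>\<Gamma>. (\<forall>i<d. k i mod int m = l i mod int m) \<longrightarrow> k = l)"

text \<open>The law of a single sampling point in the continuous and in the discrete model.\<close>

inductive sampling_law :: "nat \<Rightarrow> (nat \<Rightarrow> int) set \<Rightarrow> (nat \<Rightarrow> real) measure \<Rightarrow> bool"
  for d \<Gamma> where
  continuous: "sampling_law d \<Gamma> (uniform_cube d)"
| discrete: "2 \<le> m \<Longrightarrow> distinct_mod d m \<Gamma> \<Longrightarrow>
    sampling_law d \<Gamma> (uniform_count_measure (grid d m))"


text \<open>
  Vectors in \<open>\<complex>\<^sup>N\<close> are functions on \<open>nat\<close> vanishing from \<open>N\<close> on; the coordinates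
  are numbered \<open>0, \<dots>, N - 1\<close>.
\<close>

definition sample :: "nat \<Rightarrow> (nat \<Rightarrow> nat \<Rightarrow> real) \<Rightarrow> ((nat \<Rightarrow> real) \<Rightarrow> complex) \<Rightarrow> nat \<Rightarrow> complex" where
  "sample N X g = (\<lambda>j. if j < N then g (X j) else 0)"

definition scalar_product :: "nat \<Rightarrow> (nat \<Rightarrow> complex) \<Rightarrow> (nat \<Rightarrow> complex) \<Rightarrow> complex" where
  "scalar_product N u v = (\<Sum>j<N. u j * cnj (v j))"

text \<open>\<open>p\<close> is the orthogonal projection of \<open>v\<close> onto the complex span of \<open>\<phi> k\<close>, \<open>k \<in> S\<close>
  (for finite \<open>S\<close>).\<close>

definition is_orthogonal_projection ::
  "nat \<Rightarrow> ('k \<Rightarrow> nat \<Rightarrow> complex) \<Rightarrow> 'k set \<Rightarrow> (nat \<Rightarrow> complex) \<Rightarrow> (nat \<Rightarrow> complex) \<Rightarrow> bool" where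
  "is_orthogonal_projection N \<phi> S v p \<longleftrightarrow>
     (\<exists>a. p = (\<lambda>j. \<Sum>k\<in>S. a k * \<phi> k j)) \<and>
     (\<forall>k\<in>S. scalar_product N (\<lambda>j. v j - p j) (\<phi> k) = 0)"

definition omp_candidate ::
  "nat \<Rightarrow> ('k \<Rightarrow> nat \<Rightarrow> complex) \<Rightarrow> 'k set \<Rightarrow> (nat \<Rightarrow> complex) \<Rightarrow> 'k \<Rightarrow> bool" where
  "omp_candidate N \<phi> \<Gamma> r k \<longleftrightarrow>
     is_arg_max (\<lambda>l. cmod (scalar_product N r (\<phi> l))) (\<lambda>l. l \<in> \<Gamma>) k"

text \<open>
  \<open>omp N \<phi> \<Gamma> v s S r\<close>: some run of OMP on input \<open>v\<close> has index set \<open>S\<close> and residual \<open>r\<close> after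
  \<open>s\<close> iterations.  It is a relation because ties may be broken arbitrarily.
\<close>

inductive omp ::
  "nat \<Rightarrow> ('k \<Rightarrow> nat \<Rightarrow> complex) \<Rightarrow> 'k set \<Rightarrow> (nat \<Rightarrow> complex) \<Rightarrow>
     nat \<Rightarrow> 'k set \<Rightarrow> (nat \<Rightarrow> complex) \<Rightarrow> bool"
  for N \<phi> \<Gamma> v where
  start: "omp N \<phi> \<Gamma> v 0 {} v"
| step: "omp N \<phi> \<Gamma> v s S r \<Longrightarrow> omp_candidate N \<phi> \<Gamma> r k \<Longrightarrow>
    is_orthogonal_projection N \<phi> (insert k S) v p \<Longrightarrow>
    omp N \<phi> \<Gamma> v (Suc s) (insert k S) (\<lambda>j. v j - p j)"

text \<open>Some run of OMP selects \<open>k\<close> in iteration \<open>s \<ge> 1\<close>.\<close>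

definition omp_can_select ::
  "nat \<Rightarrow> ('k \<Rightarrow> nat \<Rightarrow> complex) \<Rightarrow> 'k set \<Rightarrow> (nat \<Rightarrow> complex) \<Rightarrow> nat \<Rightarrow> 'k \<Rightarrow> bool" where
  "omp_can_select N \<phi> \<Gamma> v s k \<longleftrightarrow>
     (\<exists>S r. omp N \<phi> \<Gamma> v (s - 1) S r \<and> omp_candidate N \<phi> \<Gamma> r k)"

end

theory Submission
  imports Defs
begin

text \<open>
  Write \<open>S\<close> for the sum of the \<open>\<bar>c\<^sub>k\<bar>\<^sup>2\<close>, so that \<open>\<bar>f\<bar>\<close> is at most the square root of \<open>M S\<close> and \<open>\<bar>f\<bar>\<^sup>2\<close>
  has mean \<open>S\<close>. The correlation \<open>\<langle>f, \<phi>\<^sub>k\<rangle> / N\<close> is an empirical mean of independent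
  variables with expectation \<open>c\<^sub>k\<close> for \<open>k \<in> T\<close> and \<open>0\<close> otherwise. If \<open>k\<^sub>0 \<in> T\<close>
  maximizes \<open>\<bar>c\<^sub>k\<bar>\<close>, with maximum \<open>a\<close>, then \<open>S \<le> M a\<^sup>2\<close>, and OMP can fail only if the correlation at
  \<open>k\<^sub>0\<close> drops to \<open>a / 2\<close> or one outside \<open>T\<close> reaches \<open>a / 2\<close>. A Chernoff bound based on
  \<open>e\<^sup>x \<le> 1 + x + x\<^sup>2\<close> for \<open>x \<le> 1\<close>, applied in the four directions \<open>1, -1, \<i>, -\<i>\<close> of the complex
  plane, makes each of at most \<open>4 D\<close> bad events have probability at most \<open>exp (- N / (32 M))\<close>.
\<close>

section \<open>Chernoff bound, and reduction of complex moduli to real parts\<close>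

text \<open>On \<open>[0, 1]\<close> this is a standard bound. For \<open>x = -y < 0\<close> it
  amounts to \<open>1 \<le> (1 - y + y\<^sup>2) * exp y\<close>, where \<open>exp y\<close> can be
  replaced by its second Taylor polynomial; hence no lower limit on \<open>x\<close>.\<close>

lemma exp_le_quadratic:
  fixes x :: real
  assumes "x \<le> 1"
  shows "exp x \<le> 1 + x + x\<^sup>2"
proof (cases "0 \<le> x")
  case True
  then show ?thesis using exp_bound assms by blast
next
  case False
  define y where "y = - x"
  have y: "y > 0" using False by (simp add: y_def)
  have "1 \<le> (1 - y + y\<^sup>2) * (1 + y + y\<^sup>2 / 2)"
  proof -
    have "(1 - y + y\<^sup>2) * (1 + y + y\<^sup>2 / 2) = 1 + (y\<^sup>2 + y^3 + y^4) / 2"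
      by (simp add: power2_eq_square power3_eq_cube power4_eq_xxxx field_simps)
    then show ?thesis using y by simp
  qed
  also have "\<dots> \<le> (1 - y + y\<^sup>2) * exp y"
  proof (rule mult_left_mono)
    show "1 + y + y\<^sup>2 / 2 \<le> exp y" using y by (intro exp_lower_Taylor_quadratic) simp
    have "1 - y + y\<^sup>2 = (1 - y/2)\<^sup>2 + 3/4 * y\<^sup>2" by (simp add: power2_eq_square field_simps)
    then show "0 \<le> 1 - y + y\<^sup>2" by simp
  qed
  finally have "exp x \<le> 1 - y + y\<^sup>2"
    by (simp add: y_def exp_minus field_simps)
  then show ?thesis by (simp add: y_def)
qed

text \<open>Markov's inequality for the exponential of the sum. The condition
  \<open>L * B \<le> 1\<close> puts \<open>L * W x\<close> in the range of the quadratic bound on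
  \<open>exp\<close>, which turns the first two moments into a bound on the moment generating
  function. \<open>L\<close> stays free so that each application can optimise it.\<close>

lemma (in prob_space) chernoff_iid_sum:
  fixes W :: "'a \<Rightarrow> real"
  assumes W [measurable]: "random_variable borel W"
    and bound: "\<And>x. x \<in> space M \<Longrightarrow> \<bar>W x\<bar> \<le> B"
    and second_moment: "expectation (\<lambda>x. (W x)\<^sup>2) \<le> v"
    and L: "0 \<le> L" "L * B \<le> 1"
  shows "measure (\<Pi>\<^sub>M j\<in>{..<N}. M) {X \<in> space (\<Pi>\<^sub>M j\<in>{..<N}. M). real N * b \<le> (\<Sum>j<N. W (X j))}
    \<le> exp (- (real N * (L * (b - expectation W) - L\<^sup>2 * v)))"
proof -
  let ?P = "\<Pi>\<^sub>M j\<in>{..<N}. M"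
  interpret P: prob_space ?P by (intro prob_space_PiM) (rule prob_space_axioms)
  interpret S: product_sigma_finite "\<lambda>_::nat. M" by standard
  have le: "L * W x \<le> 1" if "x \<in> space M" for x
  proof -
    have "L * W x \<le> L * B" using bound[OF that] L(1) by (intro mult_left_mono) auto
    then show ?thesis using L(2) by simp
  qed
  have int_W: "integrable M W"
    using bound by (intro integrable_const_bound[where B = B]) auto
  have "\<bar>(W x)\<^sup>2\<bar> \<le> B\<^sup>2" if "x \<in> space M" for x
    using power_mono[OF bound[OF that], of 2] by simp
  then have int_W2: "integrable M (\<lambda>x. (W x)\<^sup>2)"
    by (intro integrable_const_bound[where B = "B\<^sup>2"]) auto
  have int_exp: "integrable M (\<lambda>x. exp (L * W x))"
    using le by (intro integrable_const_bound[where B = "exp 1"]) auto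
  have "expectation (\<lambda>x. exp (L * W x)) \<le> expectation (\<lambda>x. 1 + L * W x + L\<^sup>2 * (W x)\<^sup>2)"
  proof (rule integral_mono[OF int_exp])
    show "exp (L * W x) \<le> 1 + L * W x + L\<^sup>2 * (W x)\<^sup>2" if "x \<in> space M" for x
      using exp_le_quadratic[OF le[OF that]] by (simp add: power_mult_distrib)
  qed (use int_W int_W2 in auto)
  also have "\<dots> = 1 + L * expectation W + L\<^sup>2 * expectation (\<lambda>x. (W x)\<^sup>2)"
    using int_W int_W2 by (simp add: prob_space)
  also have "\<dots> \<le> 1 + (L * expectation W + L\<^sup>2 * v)"
    using second_moment by (simp add: mult_left_mono)
  also have "\<dots> \<le> exp (L * expectation W + L\<^sup>2 * v)"
    by (rule exp_ge_add_one_self)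
  finally have mgf: "expectation (\<lambda>x. exp (L * W x)) \<le> exp (L * expectation W + L\<^sup>2 * v)" .
  \<comment> \<open>Written as a product over single coordinates, the exponential of the sum has an
    expectation that factorises under the product measure.\<close>
  let ?E = "\<lambda>X. \<Prod>j<N. exp (L * W (X j))"
  have E: "?E X = exp (L * (\<Sum>j<N. W (X j)))" for X
    by (simp add: exp_sum sum_distrib_left)
  have "measure ?P {X \<in> space ?P. real N * b \<le> (\<Sum>j<N. W (X j))}
      \<le> measure ?P {X \<in> space ?P. exp (L * (real N * b)) \<le> ?E X}"
  proof (rule P.finite_measure_mono)
    show "{X \<in> space ?P. real N * b \<le> (\<Sum>j<N. W (X j))}
        \<subseteq> {X \<in> space ?P. exp (L * (real N * b)) \<le> ?E X}"
      unfolding E using L(1) by (auto intro!: mult_left_mono)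
  qed measurable
  also have "\<dots> \<le> P.expectation ?E / exp (L * (real N * b))"
  proof (rule integral_Markov_inequality_measure[where A = "{}"])
    show "integrable ?P ?E"
      by (rule S.product_integrable_prod) (use int_exp in auto)
  qed (auto simp: prod_nonneg)
  also have "P.expectation ?E = (\<Prod>j<N. expectation (\<lambda>x. exp (L * W x)))"
    by (rule S.product_integral_prod) (use int_exp in auto)
  also have "\<dots> / exp (L * (real N * b)) \<le>
      (exp (L * expectation W + L\<^sup>2 * v))^N / exp (L * (real N * b))"
    using mgf by (intro divide_right_mono) (auto intro!: power_mono)
  also have "\<dots> = exp (- (real N * (L * (b - expectation W) - L\<^sup>2 * v)))"
    by (simp add: exp_of_nat_mult[symmetric] exp_diff[symmetric] algebra_simps)
  finally show ?thesis .
qed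

text \<open>If all four real parts stay below \<open>a\<close>, then both \<open>Re z\<close> and
  \<open>Im z\<close> have absolute value below \<open>a\<close>. This replaces the tail of a
  modulus by four real tails, at the price of a factor \<open>sqrt 2\<close>.\<close>

lemma cmod_ge_direction:
  assumes "sqrt 2 * a \<le> cmod z"
  shows "\<exists>w\<in>{1, -1, \<i>, -\<i>}. a \<le> Re (w * z)"
proof (rule ccontr)
  assume "\<not> ?thesis"
  then have "\<bar>Re z\<bar> < a" "\<bar>Im z\<bar> < a" by auto
  then have "(Re z)\<^sup>2 < a\<^sup>2" "(Im z)\<^sup>2 < a\<^sup>2"
    by (metis abs_ge_zero power2_abs power_strict_mono zero_less_numeral)+
  then have "cmod z < sqrt (2 * a\<^sup>2)" unfolding cmod_def by (intro real_sqrt_less_mono) simp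
  also have "\<dots> = sqrt 2 * a" using \<open>\<bar>Re z\<bar> < a\<close> by (simp add: real_sqrt_mult)
  finally show False using assms by simp
qed

lemma borel_measurable_cnj [measurable (raw)]:
  "f \<in> borel_measurable M \<Longrightarrow> (\<lambda>x. cnj (f x)) \<in> borel_measurable M"
  by (rule borel_measurable_continuous_on) (intro continuous_intros)

section \<open>Correlations in an orthonormal system of unimodular functions\<close>

text \<open>The common abstraction of both sampling models: \<open>M\<close> is the law of one
  sampling point, and the sample is drawn from its \<open>N\<close>-fold product.\<close>

locale unimodular_orthonormal_system = prob_space M for M :: "'a measure" +
  fixes \<Gamma> :: "'k set" and \<phi> :: "'k \<Rightarrow> 'a \<Rightarrow> complex"
  assumes finite_index: "finite \<Gamma>"
    and measurable_system [measurable]: "\<And>k. \<phi> k \<in> borel_measurable M"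
    and norm_system [simp]: "\<And>k x. cmod (\<phi> k x) = 1"
    and orthonormal: "\<And>k l. k \<in> \<Gamma> \<Longrightarrow> l \<in> \<Gamma> \<Longrightarrow>
      expectation (\<lambda>x. \<phi> k x * cnj (\<phi> l x)) = (if k = l then 1 else 0)"
begin

context
  fixes T :: "'k set" and c :: "'k \<Rightarrow> complex"
  assumes T: "T \<subseteq> \<Gamma>"
begin

definition poly_sum :: "'a \<Rightarrow> complex" where
  "poly_sum x = (\<Sum>k\<in>T. c k * \<phi> k x)"

definition energy :: real where
  "energy = (\<Sum>k\<in>T. (cmod (c k))\<^sup>2)"

text \<open>The scalar product of the two sample vectors, not divided by \<open>N\<close>;
  thresholds for it therefore carry a factor \<open>N\<close>.\<close>

definition corr :: "nat \<Rightarrow> (nat \<Rightarrow> 'a) \<Rightarrow> 'k \<Rightarrow> complex" where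
  "corr N X k = (\<Sum>j<N. poly_sum (X j) * cnj (\<phi> k (X j)))"

lemma finite_T: "finite T"
  using T finite_index finite_subset by blast

lemma poly_sum_measurable [measurable]: "poly_sum \<in> borel_measurable M"
  unfolding poly_sum_def by measurable

text \<open>Triangle inequality, then Cauchy-Schwarz for the coefficients.\<close>

lemma cmod_poly_sum_le: "cmod (poly_sum x) \<le> sqrt (real (card T) * energy)"
proof -
  have "cmod (poly_sum x) \<le> (\<Sum>k\<in>T. cmod (c k))"
    unfolding poly_sum_def by (rule sum_norm_le) (simp add: norm_mult)
  moreover have "(\<Sum>k\<in>T. cmod (c k))\<^sup>2 \<le> energy * real (card T)"
    unfolding energy_def by (rule sum_squared_le_sum_of_squares)
  ultimately show ?thesis
    by (metis mult.commute order_trans real_le_rsqrt)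
qed

lemma integrable_product: "integrable M (\<lambda>x. \<phi> k x * cnj (\<phi> l x))"
  by (intro integrable_const_bound[where B = 1]) (auto simp: norm_mult)

lemma poly_sum_coefficient:
  assumes "l \<in> \<Gamma>"
  shows "expectation (\<lambda>x. poly_sum x * cnj (\<phi> l x)) = (if l \<in> T then c l else 0)"
proof -
  have "expectation (\<lambda>x. poly_sum x * cnj (\<phi> l x))
      = expectation (\<lambda>x. \<Sum>k\<in>T. c k * (\<phi> k x * cnj (\<phi> l x)))"
    by (simp add: poly_sum_def sum_distrib_right mult.assoc)
  also have "\<dots> = (\<Sum>k\<in>T. c k * expectation (\<lambda>x. \<phi> k x * cnj (\<phi> l x)))"
    by (subst Bochner_Integration.integral_sum) (auto intro: integrable_product)
  also have "\<dots> = (\<Sum>k\<in>T. if k = l then c k else 0)"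
    using T assms by (intro sum.cong) (auto simp: orthonormal)
  finally show ?thesis using finite_T by (simp add: sum.delta)
qed

lemma integrable_coefficient: "integrable M (\<lambda>x. poly_sum x * cnj (\<phi> l x))"
  using cmod_poly_sum_le
  by (intro integrable_const_bound[where B = "sqrt (real (card T) * energy)"])
     (auto simp: norm_mult)

lemma parseval: "expectation (\<lambda>x. (cmod (poly_sum x))\<^sup>2) = energy"
proof -
  \<comment> \<open>The computation runs in the complex numbers: expanding only the conjugated
    factor reduces it to the coefficient formula.\<close>
  have "complex_of_real (expectation (\<lambda>x. (cmod (poly_sum x))\<^sup>2))
      = expectation (\<lambda>x. poly_sum x * cnj (poly_sum x))"
    by (simp flip: complex_norm_square integral_complex_of_real)
  also have "\<dots> = expectation (\<lambda>x. \<Sum>l\<in>T. cnj (c l) * (poly_sum x * cnj (\<phi> l x)))"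
  proof -
    have "cnj (poly_sum x) = (\<Sum>l\<in>T. cnj (c l) * cnj (\<phi> l x))" for x
      by (simp add: poly_sum_def)
    then show ?thesis by (simp add: sum_distrib_left mult.left_commute)
  qed
  also have "\<dots> = (\<Sum>l\<in>T. cnj (c l) * expectation (\<lambda>x. poly_sum x * cnj (\<phi> l x)))"
    by (subst Bochner_Integration.integral_sum) (auto intro: integrable_coefficient)
  also have "\<dots> = (\<Sum>l\<in>T. cnj (c l) * c l)"
    using T by (intro sum.cong) (auto simp: poly_sum_coefficient)
  also have "\<dots> = complex_of_real energy"
    by (simp add: energy_def complex_norm_square mult.commute del: of_real_power)
  finally show ?thesis using of_real_eq_iff by blast
qed

text \<open>Each summand of \<open>Re (w * corr N X k)\<close> is at most
  \<open>cmod (poly_sum x)\<close> in absolute value. This gives the Chernoff bound both its sup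
  norm, by Cauchy-Schwarz, and its second moment, by Parseval.\<close>

lemma corr_tail:
  assumes "k \<in> \<Gamma>" "cmod w = 1" "0 \<le> L" "L * sqrt (real (card T) * energy) \<le> 1"
  shows "measure (\<Pi>\<^sub>M j\<in>{..<N}. M) {X \<in> space (\<Pi>\<^sub>M j\<in>{..<N}. M). real N * b \<le> Re (w * corr N X k)}
    \<le> exp (- (real N * (L * (b - Re (w * (if k \<in> T then c k else 0))) - L\<^sup>2 * energy)))"
proof -
  define W where "W x = Re (w * (poly_sum x * cnj (\<phi> k x)))" for x
  have W_meas [measurable]: "W \<in> borel_measurable M" unfolding W_def by measurable
  have W_le: "\<bar>W x\<bar> \<le> cmod (poly_sum x)" for x
    using abs_Re_le_cmod[of "w * (poly_sum x * cnj (\<phi> k x))"] assms(2)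
    by (simp add: W_def norm_mult)
  have W_bound: "\<bar>W x\<bar> \<le> sqrt (real (card T) * energy)" for x
    using W_le[of x] cmod_poly_sum_le[of x] by linarith
  have "(cmod (poly_sum x))\<^sup>2 \<le> (sqrt (real (card T) * energy))\<^sup>2" for x
    by (intro power_mono cmod_poly_sum_le) simp
  then have int: "integrable M (\<lambda>x. (cmod (poly_sum x))\<^sup>2)"
    by (intro integrable_const_bound[where B = "(sqrt (real (card T) * energy))\<^sup>2"]) auto
  have W2: "(W x)\<^sup>2 \<le> (cmod (poly_sum x))\<^sup>2" for x
    using power_mono[OF W_le[of x], of 2] by simp
  have int_W2: "integrable M (\<lambda>x. (W x)\<^sup>2)"
    using W2 by (intro Bochner_Integration.integrable_bound[OF int]) auto
  have "expectation (\<lambda>x. (W x)\<^sup>2) \<le> energy"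
    unfolding parseval[symmetric] using W2 by (intro integral_mono int int_W2) auto
  moreover have "expectation W = Re (w * (if k \<in> T then c k else 0))"
  proof -
    have "expectation W = Re (expectation (\<lambda>x. w * (poly_sum x * cnj (\<phi> k x))))"
      unfolding W_def by (intro integral_Re integrable_mult_right integrable_coefficient)
    then show ?thesis by (simp add: poly_sum_coefficient[OF assms(1)])
  qed
  moreover have "(\<Sum>j<N. W (X j)) = Re (w * corr N X k)" for X
    by (simp add: W_def corr_def sum_distrib_left Re_sum)
  ultimately show ?thesis
    using chernoff_iid_sum[OF W_meas W_bound _ assms(3,4), of energy N b] by simp
qed

section \<open>Union bound over the bad events\<close>

text \<open>The strict inequality excludes indices outside \<open>T\<close> from the maximum however
  ties are broken. The competitor \<open>l\<close> is always a \<open>k0\<close> in \<open>T\<close>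
  with largest coefficient.\<close>

theorem correlation_max_in_support:
  assumes c: "\<exists>k\<in>T. c k \<noteq> 0" and \<epsilon>: "0 < \<epsilon>"
    and N: "32 * real (card T) * ln (8 * real (card \<Gamma>) / \<epsilon>) \<le> real N"
  shows "1 - \<epsilon> \<le> measure (\<Pi>\<^sub>M j\<in>{..<N}. M)
    {X \<in> space (\<Pi>\<^sub>M j\<in>{..<N}. M). \<forall>k\<in>\<Gamma> - T. \<exists>l\<in>\<Gamma>. cmod (corr N X k) < cmod (corr N X l)}"
proof -
  let ?P = "\<Pi>\<^sub>M j\<in>{..<N}. M"
  interpret P: prob_space ?P by (intro prob_space_PiM) (rule prob_space_axioms)
  define m where "m = real (card T)"
  define S where "S = energy"
  have "T \<noteq> {}" using c by auto
  then have m: "m \<ge> 1" using finite_T by (simp add: m_def Suc_leI card_gt_0_iff)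
  obtain k0 where k0: "k0 \<in> T" "\<And>k. k \<in> T \<Longrightarrow> cmod (c k) \<le> cmod (c k0)"
    using obtains_MAX[OF finite_T \<open>T \<noteq> {}\<close>, of "\<lambda>k. cmod (c k)"] finite_T
    by (metis Max_ge finite_imageI image_eqI)
  define a where "a = cmod (c k0)"
  have a: "a > 0"
  proof -
    obtain k where "k \<in> T" "c k \<noteq> 0" using c by blast
    then have "0 < cmod (c k)" "cmod (c k) \<le> a" using k0(2) by (auto simp: a_def)
    then show ?thesis by linarith
  qed
  have S_le: "S \<le> m * a\<^sup>2"
    unfolding S_def energy_def m_def a_def
    by (rule sum_bounded_above) (use k0(2) in \<open>simp add: power_mono\<close>)
  have "a\<^sup>2 \<le> S"
    unfolding S_def energy_def a_def by (rule member_le_sum) (use k0(1) finite_T in auto)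
  then have S: "S > 0" using a by (smt (verit) zero_less_power)
  define \<delta> where "\<delta> = exp (- (real N / (32 * m)))"
  \<comment> \<open>This direction rotates \<open>c k0\<close> to \<open>- a\<close>, so a
    correlation at \<open>k0\<close> that is too small becomes an upper tail in a single direction,
    without the loss of \<open>sqrt 2\<close>.\<close>
  define w0 where "w0 = - cnj (sgn (c k0))"
  have w0: "cmod w0 = 1" "Re (w0 * c k0) = - a"
  proof -
    have "c k0 \<noteq> 0" using a by (auto simp: a_def)
    then show "cmod w0 = 1" by (simp add: w0_def norm_sgn)
    have "cnj (sgn (c k0)) * c k0 = (c k0 * cnj (c k0)) /\<^sub>R a"
      by (simp add: sgn_div_norm a_def mult.commute)
    also have "\<dots> = of_real a"
      using a by (simp add: complex_norm_square[symmetric] a_def[symmetric] scaleR_conv_of_real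
          power2_eq_square)
    finally show "Re (w0 * c k0) = - a" by (simp add: w0_def)
  qed
  define B0 where "B0 = {X \<in> space ?P. real N * (- a / 2) \<le> Re (w0 * corr N X k0)}"
  \<comment> \<open>Chosen so that \<open>sqrt 2 * b = sqrt (S / (4 * m))\<close>, which is at most
    \<open>a / 2\<close> because \<open>S \<le> m * a\<^sup>2\<close>.\<close>
  define b where "b = sqrt (S / (8 * m))"
  define B where "B p = {X \<in> space ?P. real N * b \<le> Re (snd p * corr N X (fst p))}" for p
  let ?I = "(\<Gamma> - T) \<times> {1, -1, \<i>, -\<i>}"
  have B0_meas [measurable]: "B0 \<in> P.events" unfolding B0_def corr_def by measurable
  have B_meas [measurable]: "B p \<in> P.events" for p unfolding B_def corr_def by measurable

  have B0: "P.prob B0 \<le> \<delta>"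
  proof -
    \<comment> \<open>The exponent is \<open>L * a / 2 - L\<^sup>2 * S\<close>. With
      \<open>a\<close> replaced by its lower bound \<open>sqrt (m * S) / m\<close>, this
      \<open>L\<close> is the maximizer, and \<open>L * sqrt (m * S) = 1 / 4\<close> is
      admissible.\<close>
    define L where "L = 1 / (4 * sqrt (m * S))"
    have pos: "sqrt (m * S) > 0" using m S by simp
    have "sqrt (m * S) \<le> sqrt ((m * a)\<^sup>2)"
      using mult_left_mono[OF S_le, of m] m
      by (intro real_sqrt_le_mono) (simp add: power2_eq_square mult_ac)
    then have le: "sqrt (m * S) \<le> m * a" using m a by simp
    have La: "1 / (4 * m) \<le> L * a"
      using le pos m unfolding L_def by (simp add: field_simps)
    have "L\<^sup>2 * S = S / (16 * (m * S))"
      using m S by (simp add: L_def power_divide power_mult_distrib)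
    then have LS: "L\<^sup>2 * S = 1 / (16 * m)" using S by simp
    have "P.prob B0 \<le> exp (- (real N * (L * (- a / 2 - Re (w0 * (if k0 \<in> T then c k0 else 0)))
        - L\<^sup>2 * energy)))"
      unfolding B0_def using k0(1) T w0(1) pos
      by (intro corr_tail) (auto simp: L_def m_def[symmetric] S_def[symmetric])
    also have "\<dots> = exp (- (real N * (L * a / 2 - 1 / (16 * m))))"
      unfolding S_def[symmetric] LS using k0(1) by (simp only: if_True w0(2)) simp
    \<comment> \<open>The exponent is even at least \<open>N / (16 * m)\<close>; it is weakened to
      share \<open>\<delta>\<close> with the other events.\<close>
    also have "\<dots> \<le> exp (- (real N * (1 / (32 * m))))"
    proof -
      have "1 / (16 * m) - 1 / (32 * m) = 1 / (32 * m)" "1 / (32 * m) \<ge> 0"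
        using m by (simp_all add: field_simps)
      then have "1 / (32 * m) \<le> L * a / 2 - 1 / (16 * m)" using La m by (simp add: field_simps)
      then have "real N * (1 / (32 * m)) \<le> real N * (L * a / 2 - 1 / (16 * m))"
        by (rule mult_left_mono) simp
      then show ?thesis by (simp only: exp_le_cancel_iff neg_le_iff_le)
    qed
    finally show ?thesis by (simp add: \<delta>_def)
  qed

  have B: "P.prob (B p) \<le> \<delta>" if "p \<in> ?I" for p
  proof -
    \<comment> \<open>Outside \<open>T\<close> the mean vanishes, and this \<open>L\<close>
      maximizes \<open>L * b - L\<^sup>2 * S\<close>. The maximum
      \<open>b\<^sup>2 / (4 * S) = 1 / (32 * m)\<close> is the source of the constant 32.\<close>
    define L where "L = b / (2 * S)"
    have b2: "b\<^sup>2 = S / (8 * m)" using m S by (simp add: b_def)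
    have b: "b \<ge> 0" using m S by (simp add: b_def)
    have "b * sqrt (m * S) = sqrt (S\<^sup>2 / 8)"
      using m S unfolding b_def by (simp add: real_sqrt_mult[symmetric] power2_eq_square)
    also have "\<dots> \<le> sqrt (S\<^sup>2)" by (intro real_sqrt_le_mono) simp
    finally have "b * sqrt (m * S) \<le> S" using S by simp
    then have L: "0 \<le> L" "L * sqrt (m * S) \<le> 1" using S b by (simp_all add: L_def field_simps)
    have "P.prob (B p) \<le> exp (- (real N * (L * (b - Re (snd p * (if fst p \<in> T then c (fst p) else 0)))
        - L\<^sup>2 * energy)))"
      unfolding B_def using that L
      by (intro corr_tail) (auto simp: m_def S_def)
    also have "\<dots> = exp (- (real N * (L * b - L\<^sup>2 * S)))" using that by (auto simp: S_def)
    also have "L * b - L\<^sup>2 * S = b\<^sup>2 / (4 * S)"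
      using S by (simp add: L_def power2_eq_square field_simps)
    also have "\<dots> = 1 / (32 * m)" using S by (simp add: b2)
    finally show ?thesis by (simp add: \<delta>_def)
  qed

  \<comment> \<open>Deterministic part: off the bad events, \<open>N * a / 2\<close> separates the
    correlation at \<open>k\<close> from the one at \<open>k0\<close>.\<close>
  have good: "cmod (corr N X k) < cmod (corr N X k0)"
    if X: "X \<in> space ?P" "X \<notin> B0" and XB: "\<And>p. p \<in> ?I \<Longrightarrow> X \<notin> B p" and k: "k \<in> \<Gamma> - T" for X k
  proof -
    have "cmod (corr N X k) < sqrt 2 * (real N * b)"
      using cmod_ge_direction[of "real N * b" "corr N X k"] XB[of "(k, _)"] X(1) k
      by (force simp: B_def)
    also have "\<dots> = real N * sqrt (S / (4 * m))"
      by (simp add: b_def real_sqrt_mult[symmetric] mult.left_commute)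
    also have "\<dots> \<le> real N * (a / 2)"
    proof (intro mult_left_mono real_le_lsqrt)
      show "S / (4 * m) \<le> (a / 2)\<^sup>2" using S_le m by (simp add: field_simps power2_eq_square)
    qed (use a S m in auto)
    also have "\<dots> < - Re (w0 * corr N X k0)" using X by (simp add: B0_def)
    also have "\<dots> \<le> cmod (corr N X k0)"
      using abs_Re_le_cmod[of "w0 * corr N X k0"] w0(1) by (simp add: norm_mult)
    finally show ?thesis .
  qed

  have card_pos: "card \<Gamma> > 0" "card T \<le> card \<Gamma>" "card T \<ge> 1"
    using T finite_index \<open>T \<noteq> {}\<close> m by (auto simp: card_gt_0_iff card_mono m_def)
  have events: "(\<Union>p\<in>?I. B p) \<in> P.events"
    using finite_index by (intro sets.finite_UN B_meas) auto
  have "P.prob (B0 \<union> (\<Union>p\<in>?I. B p)) \<le> P.prob B0 + P.prob (\<Union>p\<in>?I. B p)"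
    using events by (intro measure_Un_le) auto
  also have "P.prob (\<Union>p\<in>?I. B p) \<le> (\<Sum>p\<in>?I. P.prob (B p))"
    using finite_index by (intro measure_UNION_le) auto
  also have "\<dots> \<le> real (card ?I) * \<delta>"
    by (rule sum_bounded_above) (rule B)
  also have "card ?I = 4 * (card \<Gamma> - card T)"
    using T finite_T by (simp add: card_cartesian_product card_Diff_subset complex_eq_iff)
  also have "P.prob B0 + real (4 * (card \<Gamma> - card T)) * \<delta> \<le> \<delta> + real (4 * (card \<Gamma> - card T)) * \<delta>"
    using B0 by simp
  also have "\<dots> = (1 + real (4 * (card \<Gamma> - card T))) * \<delta>" by (simp add: algebra_simps)
  \<comment> \<open>Since \<open>T\<close> is nonempty, the four directions saved per element of
    \<open>T\<close> make room for the single event \<open>B0\<close>.\<close>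
  also have "\<dots> \<le> real (4 * card \<Gamma>) * \<delta>"
    using card_pos by (intro mult_right_mono) (auto simp: \<delta>_def of_nat_diff)
  also have "\<dots> \<le> real (4 * card \<Gamma>) * (\<epsilon> / (8 * real (card \<Gamma>)))"
  proof (rule mult_left_mono)
    \<comment> \<open>Only the positive factor \<open>32 * m\<close> is moved across, so the sign of
      the logarithm is irrelevant and large \<open>\<epsilon>\<close> are covered.\<close>
    have "ln (8 * real (card \<Gamma>) / \<epsilon>) \<le> real N / (32 * m)"
      using N m by (simp add: m_def field_simps)
    then have "\<delta> \<le> exp (- ln (8 * real (card \<Gamma>) / \<epsilon>))" by (simp add: \<delta>_def)
    also have "\<dots> = \<epsilon> / (8 * real (card \<Gamma>))"
      using \<epsilon> card_pos by (simp add: exp_minus)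
    finally show "\<delta> \<le> \<epsilon> / (8 * real (card \<Gamma>))" .
  qed simp
  also have "\<dots> \<le> \<epsilon>" using \<epsilon> card_pos by simp
  finally have "1 - \<epsilon> \<le> 1 - P.prob (B0 \<union> (\<Union>p\<in>?I. B p))" by simp
  also have "\<dots> = P.prob (space ?P - (B0 \<union> (\<Union>p\<in>?I. B p)))"
    using events by (subst P.prob_compl) auto
  also have "\<dots> \<le> P.prob {X \<in> space ?P. \<forall>k\<in>\<Gamma> - T. \<exists>l\<in>\<Gamma>. cmod (corr N X k) < cmod (corr N X l)}"
  proof (rule P.finite_measure_mono)
    show "space ?P - (B0 \<union> (\<Union>p\<in>?I. B p))
        \<subseteq> {X \<in> space ?P. \<forall>k\<in>\<Gamma> - T. \<exists>l\<in>\<Gamma>. cmod (corr N X k) < cmod (corr N X l)}"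
    proof
      fix X assume X: "X \<in> space ?P - (B0 \<union> (\<Union>p\<in>?I. B p))"
      have "X \<notin> B p" if "p \<in> ?I" for p
        using UN_I[OF that, of X B] X by (simp only: Diff_iff Un_iff) blast
      then have "\<forall>k\<in>\<Gamma> - T. cmod (corr N X k) < cmod (corr N X k0)"
        using good X by blast
      then show "X \<in> {X \<in> space ?P. \<forall>k\<in>\<Gamma> - T. \<exists>l\<in>\<Gamma>. cmod (corr N X k) < cmod (corr N X l)}"
        using X k0(1) T by blast
    qed
    have [measurable]: "countable (\<Gamma> - T)" "countable \<Gamma>"
      using finite_index by (auto intro: countable_finite)
    show "{X \<in> space ?P. \<forall>k\<in>\<Gamma> - T. \<exists>l\<in>\<Gamma>. cmod (corr N X k) < cmod (corr N X l)} \<in> P.events"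
      unfolding corr_def by measurable
  qed
  finally show ?thesis .
qed

end

end

section \<open>Orthonormality of the characters under both sampling laws\<close>

lemma character_measurable_of_coordinates:
  assumes "\<And>i. i < d \<Longrightarrow> (\<lambda>x. x i) \<in> borel_measurable M"
  shows "character d k \<in> borel_measurable M"
  unfolding character_def using assms by measurable

lemma cmod_character [simp]: "cmod (character d k x) = 1"
  by (simp add: character_def)

text \<open>Splitting into one factor per coordinate reduces both orthogonality relations to
  dimension one.\<close>

lemma character_times_cnj:
  "character d k x * cnj (character d l x) = (\<Prod>i<d. exp (\<i> * of_int (k i - l i) * of_real (x i)))"
proof -
  have "character d k x * cnj (character d l x)
      = exp (\<i> * of_real (\<Sum>i<d. of_int (k i) * x i) - \<i> * of_real (\<Sum>i<d. of_int (l i) * x i))"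
    by (simp add: character_def exp_cnj exp_diff exp_minus divide_inverse)
  also have "\<i> * of_real (\<Sum>i<d. of_int (k i) * x i) - \<i> * of_real (\<Sum>i<d. of_int (l i) * x i)
      = (\<Sum>i<d. \<i> * of_int (k i - l i) * of_real (x i))"
    by (simp add: sum_distrib_left sum_subtractf[symmetric] algebra_simps)
  finally show ?thesis by (simp add: exp_sum)
qed

lemma integral_exp_uniform_interval:
  "(\<integral>x. exp (\<i> * of_int n * of_real x) \<partial>uniform_measure lborel {0..2 * pi})
    = (if n = 0 then 1 else 0)"
proof -
  let ?f = "\<lambda>x::real. exp (\<i> * of_int n * of_real x)"
  interpret prob_space "uniform_measure lborel {0..2 * pi}"
    by (rule prob_space_uniform_measure) auto
  show ?thesis
  proof (cases "n = 0")
    case True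
    then show ?thesis by (simp add: prob_space)
  next
    case False
    have "(?f has_integral
        exp (\<i> * of_int n * of_real (2 * pi)) / (\<i> * of_int n) - exp (\<i> * of_int n * of_real 0) / (\<i> * of_int n))
        {0..2 * pi}"
      by (rule fundamental_theorem_of_calculus)
         (use False in \<open>auto intro!: derivative_eq_intros has_vector_derivative_real_field\<close>)
    moreover have "exp (\<i> * of_int n * of_real (2 * pi)) = 1"
      using exp_2pi_1_int[of n] by (simp add: mult_ac)
    ultimately have "integral {0..2 * pi} ?f = 0"
      by (simp add: integral_unique)
    moreover have "set_integrable lborel {0..2 * pi} ?f"
      by (intro borel_integrable_atLeastAtMost' continuous_intros)
    ultimately have 0: "(LINT x:{0..2 * pi}|lborel. ?f x) = 0"
      by (simp add: set_borel_integral_eq_integral)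
    \<comment> \<open>A real-valued density turns the expectation into \<open>1 / (2 * pi)\<close>
      times the set integral just computed from the periodic primitive.\<close>
    have "uniform_measure lborel {0..2 * pi}
        = density lborel (\<lambda>x. ennreal (indicator {0..2 * pi} x / (2 * pi)))"
      unfolding uniform_measure_def
      by (intro density_cong) (auto simp: divide_ennreal[symmetric] split: split_indicator)
    then have "integral\<^sup>L (uniform_measure lborel {0..2 * pi}) ?f
        = (LINT x|lborel. (indicator {0..2 * pi} x / (2 * pi)) *\<^sub>R ?f x)"
      by (simp add: integral_density)
    also have "\<dots> = (LINT x|lborel. (1 / (2 * pi)) *\<^sub>R (indicator {0..2 * pi} x *\<^sub>R ?f x))"
      by simp
    also have "\<dots> = (1 / (2 * pi)) *\<^sub>R (LINT x:{0..2 * pi}|lborel. ?f x)"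
      unfolding set_lebesgue_integral_def by (rule integral_scaleR_right)
    finally show ?thesis using 0 False by simp
  qed
qed

text \<open>A geometric sum over powers of an \<open>m\<close>-th root of unity \<open>z\<close>: it
  vanishes unless \<open>z = 1\<close>, that is, unless \<open>m\<close> divides
  \<open>n\<close>.\<close>

lemma sum_exp_equispaced:
  assumes "m > 0"
  shows "(\<Sum>a<m. exp (\<i> * of_int n * of_real (2 * pi * real a / real m)))
    = (if int m dvd n then of_nat m else 0)"
proof -
  define z where "z = exp (\<i> * of_int n * of_real (2 * pi / real m))"
  have pow: "exp (\<i> * of_int n * of_real (2 * pi * real a / real m)) = z ^ a" for a
    by (simp add: z_def exp_of_nat_mult[symmetric] mult_ac)
  have "z ^ m = exp (\<i> * (of_int n * (of_real pi * 2)))"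
    using assms pow[of m] by (simp add: mult_ac)
  then have zm: "z ^ m = 1" by simp
  have z1: "z = 1 \<longleftrightarrow> int m dvd n"
  proof
    assume "z = 1"
    then obtain j :: int where "of_int n * (2 * pi / real m) = of_int (2 * j) * pi"
      by (auto simp: z_def exp_eq_1)
    then have "real_of_int n = real_of_int (j * int m)"
      using assms by (simp add: field_simps)
    then show "int m dvd n" by (metis dvd_triv_right of_int_eq_iff)
  next
    assume "int m dvd n"
    then obtain j where "n = int m * j" ..
    then have "z = exp (\<i> * (of_int j * (of_real pi * 2)))"
      using assms by (simp add: z_def mult_ac)
    then show "z = 1" by simp
  qed
  have "(z - 1) * (\<Sum>a<m. z ^ a) = 0"
    using power_diff_1_eq[of z m] zm by simp
  then show ?thesis unfolding pow using z1 by auto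
qed

lemma finite_grid: "finite (grid d m)"
  unfolding grid_def by (intro finite_PiE) auto

lemma inj_on_grid_points: "m > 0 \<Longrightarrow> inj_on (\<lambda>a. 2 * pi * real a / real m) {..<m}"
  by (auto simp: inj_on_def)

lemma card_grid: "m > 0 \<Longrightarrow> card (grid d m) = m ^ d"
  unfolding grid_def by (simp add: card_PiE card_image inj_on_grid_points)

text \<open>Fubini over the coordinates. The value stays a product of coordinatewise deltas, because
  agreement below \<open>d\<close> means \<open>k = l\<close> only for extensional
  functions.\<close>

lemma integral_character_uniform_cube:
  "(\<integral>x. character d k x * cnj (character d l x) \<partial>uniform_cube d)
    = (\<Prod>i<d. if k i = l i then 1 else 0)"
proof -
  interpret U: prob_space "uniform_measure lborel {0..2 * pi}"
    by (rule prob_space_uniform_measure) auto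
  interpret product_sigma_finite "\<lambda>_::nat. uniform_measure lborel {0..2 * pi}"
    by standard
  have "(\<integral>x. character d k x * cnj (character d l x) \<partial>uniform_cube d)
      = (\<Prod>i<d. \<integral>x. exp (\<i> * of_int (k i - l i) * of_real x) \<partial>uniform_measure lborel {0..2 * pi})"
    unfolding uniform_cube_def character_times_cnj
  proof (rule product_integral_prod)
    show "integrable (uniform_measure lborel {0..2 * pi}) (\<lambda>x. exp (\<i> * of_int (k i - l i) * of_real x))" for i
      by (intro U.integrable_const_bound[where B = 1]) auto
  qed simp
  also have "\<dots> = (\<Prod>i<d. if k i = l i then 1 else 0)"
    unfolding integral_exp_uniform_interval by simp
  finally show ?thesis .
qed

text \<open>The grid is a product set, so the sum of products is a product of one-dimensional sums.
  These see frequencies only modulo \<open>m\<close> (aliasing), whence the congruences.\<close>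

lemma integral_character_grid:
  assumes "m > 0"
  shows "(\<integral>x. character d k x * cnj (character d l x) \<partial>uniform_count_measure (grid d m))
    = (\<Prod>i<d. if k i mod int m = l i mod int m then 1 else 0)"
proof -
  let ?g = "\<lambda>a. 2 * pi * real a / real m"
  have "(\<integral>x. character d k x * cnj (character d l x) \<partial>uniform_count_measure (grid d m))
      = (\<Sum>x\<in>grid d m. \<Prod>i<d. exp (\<i> * of_int (k i - l i) * of_real (x i))) / of_nat m ^ d"
    unfolding uniform_count_measure_def
    by (simp add: lebesgue_integral_point_measure_finite finite_grid card_grid assms
        character_times_cnj scaleR_conv_of_real sum_divide_distrib)
  also have "(\<Sum>x\<in>grid d m. \<Prod>i<d. exp (\<i> * of_int (k i - l i) * of_real (x i)))
      = (\<Prod>i<d. \<Sum>y\<in>?g ` {..<m}. exp (\<i> * of_int (k i - l i) * of_real y))"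
    unfolding grid_def by (subst prod_sum_PiE) auto
  also have "\<dots> = (\<Prod>i<d. if int m dvd k i - l i then of_nat m else 0)"
    by (simp only: sum.reindex[OF inj_on_grid_points[OF assms]] o_def sum_exp_equispaced[OF assms])
  also have "\<dots> / of_nat m ^ d = (\<Prod>i<d. (if int m dvd k i - l i then of_nat m else 0) / of_nat m)"
    by (simp add: prod_dividef)
  also have "\<dots> = (\<Prod>i<d. if k i mod int m = l i mod int m then 1 else 0)"
    using assms by (intro prod.cong) (auto simp: mod_eq_dvd_iff)
  finally show ?thesis .
qed

section \<open>The first iteration of OMP\<close>

text \<open>Iteration 1 starts from the state after 0 iterations, which only the rule
  \<open>start\<close> can produce; its residual is \<open>v\<close> itself.\<close>

lemma omp_can_select_1_iff:
  "omp_can_select N \<phi> \<Gamma> v 1 k \<longleftrightarrow> omp_candidate N \<phi> \<Gamma> v k"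
proof -
  have "omp N \<phi> \<Gamma> v 0 S r \<longleftrightarrow> S = {} \<and> r = v" for S r
    by (subst omp.simps) auto
  then show ?thesis by (simp add: omp_can_select_def)
qed

lemma sampling_law_orthonormal:
  assumes "sampling_law d \<Gamma> \<mu>" "\<Gamma> \<subseteq> freqs d" "finite \<Gamma>"
  shows "unimodular_orthonormal_system \<mu> \<Gamma> (character d)"
  using assms(1)
proof cases
  case continuous
  interpret prob_space "uniform_cube d"
    unfolding uniform_cube_def
    by (intro prob_space_PiM prob_space_uniform_measure) auto
  show ?thesis unfolding continuous
  proof
    have "(\<lambda>x. x i) \<in> borel_measurable (uniform_cube d)" if "i < d" for i
    proof -
      have "(\<lambda>x. x i) \<in> measurable (uniform_cube d) (uniform_measure lborel {0..2 * pi})"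
        unfolding uniform_cube_def by (rule measurable_component_singleton) (use that in simp)
      also have "measurable (uniform_cube d) (uniform_measure lborel {0..2 * pi})
          = borel_measurable (uniform_cube d)"
        by (intro measurable_cong_sets) auto
      finally show ?thesis .
    qed
    then show "character d k \<in> borel_measurable (uniform_cube d)" for k
      by (rule character_measurable_of_coordinates)
    fix k l assume kl: "k \<in> \<Gamma>" "l \<in> \<Gamma>"
    then have "k \<in> freqs d" "l \<in> freqs d" using assms(2) by auto
    \<comment> \<open>Membership in \<open>freqs d\<close> makes both functions extensional on
      \<open>{..<d}\<close>.\<close>
    then have "k = l \<longleftrightarrow> (\<forall>i<d. k i = l i)"
      unfolding freqs_def by (auto intro: PiE_ext)
    then show "expectation (\<lambda>x. character d k x * cnj (character d l x)) = (if k = l then 1 else 0)"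
      unfolding integral_character_uniform_cube by auto
  qed (use assms(3) in auto)
next
  case (discrete m)
  then have m: "m > 0" by simp
  have "grid d m \<noteq> {}" using card_grid[OF m, of d] m by auto
  then interpret prob_space "uniform_count_measure (grid d m)"
    by (rule prob_space_uniform_count_measure[OF finite_grid])
  show ?thesis unfolding discrete
  proof
    show "character d k \<in> borel_measurable (uniform_count_measure (grid d m))" for k
      by (auto simp: measurable_def space_uniform_count_measure sets_uniform_count_measure)
    fix k l assume kl: "k \<in> \<Gamma>" "l \<in> \<Gamma>"
    \<comment> \<open>Here distinctness modulo \<open>m\<close> takes over the role of
      extensionality and rules out aliasing inside \<open>\<Gamma>\<close>.\<close>
    then have "k = l \<longleftrightarrow> (\<forall>i<d. k i mod int m = l i mod int m)"
      using discrete(3) unfolding distinct_mod_def by blast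
    then show "expectation (\<lambda>x. character d k x * cnj (character d l x)) = (if k = l then 1 else 0)"
      unfolding integral_character_grid[OF m] by auto
  qed (use assms(3) in auto)
qed

lemma omp_first_selection_prob:
  assumes "sampling_law d \<Gamma> \<mu>" "\<Gamma> \<subseteq> freqs d" "finite \<Gamma>" "T \<subseteq> \<Gamma>"
    and nonzero: "trig_poly d T c y \<noteq> 0" and "0 < \<epsilon>"
    and "32 * real (card T) * ln (8 * real (card \<Gamma>) / \<epsilon>) \<le> real N"
  shows "1 - \<epsilon> \<le> \<P>(X in (\<Pi>\<^sub>M j\<in>{..<N}. \<mu>).
    \<forall>k. omp_can_select N (\<lambda>l. sample N X (character d l)) \<Gamma>
          (sample N X (trig_poly d T c)) 1 k \<longrightarrow> k \<in> T)"
proof -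
  interpret unimodular_orthonormal_system \<mu> \<Gamma> "character d"
    using assms(1-3) by (rule sampling_law_orthonormal)
  have corr: "scalar_product N (sample N X (trig_poly d T c)) (sample N X (character d l))
      = corr T c N X l" for X l
    by (simp add: scalar_product_def sample_def corr_def[OF assms(4)] poly_sum_def[OF assms(4)]
        trig_poly_def)
  have "\<exists>k\<in>T. c k \<noteq> 0"
  proof (rule ccontr)
    assume "\<not> ?thesis"
    then have "trig_poly d T c y = 0" by (simp add: trig_poly_def)
    with nonzero show False by contradiction
  qed
  from correlation_max_in_support[OF assms(4) this assms(6,7)]
  have "1 - \<epsilon> \<le> \<P>(X in (\<Pi>\<^sub>M j\<in>{..<N}. \<mu>).
    \<forall>k\<in>\<Gamma> - T. \<exists>l\<in>\<Gamma>. cmod (corr T c N X k) < cmod (corr T c N X l))" .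
  \<comment> \<open>Candidates lie in \<open>\<Gamma>\<close>, and an index of
    \<open>\<Gamma>\<close> fails to be one exactly when another correlation is strictly larger; so
    both events coincide.\<close>
  moreover have "(\<forall>k. omp_can_select N (\<lambda>l. sample N X (character d l)) \<Gamma>
        (sample N X (trig_poly d T c)) 1 k \<longrightarrow> k \<in> T)
      \<longleftrightarrow> (\<forall>k\<in>\<Gamma> - T. \<exists>l\<in>\<Gamma>. cmod (corr T c N X k) < cmod (corr T c N X l))" for X
    unfolding omp_can_select_1_iff omp_candidate_def is_arg_max_def corr by blast
  ultimately show ?thesis by (simp only:)
qed

theorem theorem2p4:
  "\<exists>C::real. C \<le> 32.62 \<and>
    (\<forall>(d::nat) (\<Gamma>::(nat \<Rightarrow> int) set) (T::(nat \<Rightarrow> int) set) (D::nat) (M::nat) (N::nat)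
       (c::(nat \<Rightarrow> int) \<Rightarrow> complex) (\<mu>::(nat \<Rightarrow> real) measure) (\<epsilon>::real).
       1 \<le> d \<longrightarrow>
       \<Gamma> \<subseteq> freqs d \<longrightarrow> finite \<Gamma> \<longrightarrow> card \<Gamma> = D \<longrightarrow>
       T \<subseteq> \<Gamma> \<longrightarrow> card T = M \<longrightarrow>
       (\<exists>x\<in>cube d. trig_poly d T c x \<noteq> 0) \<longrightarrow>
       sampling_law d \<Gamma> \<mu> \<longrightarrow>
       0 < \<epsilon> \<longrightarrow>
       C * real M * ln (8 * real D / \<epsilon>) \<le> real N \<longrightarrow>
       1 - \<epsilon> \<le> \<P>(X in (\<Pi>\<^sub>M j\<in>{..<N}. \<mu>).
         \<forall>k. omp_can_select N (\<lambda>l. sample N X (character d l)) \<Gamma>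
               (sample N X (trig_poly d T c)) 1 k \<longrightarrow> k \<in> T))"
proof -
  have "1 - \<epsilon> \<le> \<P>(X in (\<Pi>\<^sub>M j\<in>{..<N}. \<mu>).
        \<forall>k. omp_can_select N (\<lambda>l. sample N X (character d l)) \<Gamma>
              (sample N X (trig_poly d T c)) 1 k \<longrightarrow> k \<in> T)"
    if "\<Gamma> \<subseteq> freqs d" "finite \<Gamma>" "T \<subseteq> \<Gamma>" "\<exists>x\<in>cube d. trig_poly d T c x \<noteq> 0"
      "sampling_law d \<Gamma> \<mu>" "0 < \<epsilon>" "32 * real (card T) * ln (8 * real (card \<Gamma>) / \<epsilon>) \<le> real N"
    for d \<Gamma> T c \<mu> \<epsilon> N
    using that omp_first_selection_prob by blast
  \<comment> \<open>The witness 32 is the constant in the exponent \<open>N / (32 * m)\<close> of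
    the tail bounds.\<close>
  then show ?thesis by (intro exI[of _ 32]) auto
qed

end
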